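(* Let $X=(X,d,\mu)$ be a doubling metric measured space with Property (M). Then there exist $\delta>0$ and a constant $C<\infty$ such that for all $x\in X$ and all integers $n\geq 1$, $$\mu(S(x,n))\leq C\,n^{-\delta}\,\mu(B(x,n)).$$ In particular, the ratio $\mu\big(B(x,n+1)\smallsetminus B(x,n)\big)/\mu(B(x,n))$ tends to $0$ uniformly in $x\in X$ when $n$ goes to infinity.
   Context: For a metric space $(X,d)$, $x\in X$ and $r>0$: $B(x,r)=\{y\in X: d(x,y)\leq r\}$ (closed ball) and $S(x,r)=B(x,r+1)\smallsetminus B(x,r)$. A metric measured space $(X,d,\mu)$ is a metric space $(X,d)$ with a Borel measure $\mu$ supported on $X$ (so balls of positive radius have positive measure) such that $\mu(B(x,r))<\infty$ for all $x\in X$, $r>0$. It is doubling if there is a constant $C_0\geq 1$ with $\mu(B(x,2r))\leq C_0\,\mu(B(x,r))$ for all $x\in X$ and all $r>0$. $(X,d)$ has Property (M) if there exists $C_1<\infty$ such that for all $x\in X$, all $r>0$ and all $y\in B(x,r+1)$, we have $d(y,B(x,r))\leq C_1$, where $d(y,A)=\inf_{a\in A}d(y,a)$. *)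

theory Defs
  imports "HOL-Analysis.Analysis"
begin

definition shell :: "'a::metric_space \<Rightarrow> real \<Rightarrow> 'a set" where
  "shell x r = cball x (r + 1) - cball x r"

text \<open>The metric space is the whole type; the support condition on the measure is expressed
  by the positivity of the measure of balls.\<close>

definition metric_measured_space :: "'a::metric_space measure \<Rightarrow> bool" where
  "metric_measured_space M \<longleftrightarrow>
     sets M = sets borel \<and>
     (\<forall>x r. r > 0 \<longrightarrow> 0 < emeasure M (cball x r) \<and> emeasure M (cball x r) < \<infinity>)"

definition doubling :: "'a::metric_space measure \<Rightarrow> bool" where
  "doubling M \<longleftrightarrow>
     (\<exists>C\<^sub>0::real. C\<^sub>0 \<ge> 1 \<and>
       (\<forall>x r. r > 0 \<longrightarrow> emeasure M (cball x (2 * r)) \<le> ennreal C\<^sub>0 * emeasure M (cball x r)))"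

text \<open>Here \<^const>\<open>infdist\<close> is the genuine infimum of distances, since \<open>cball x r\<close> contains \<open>x\<close>.\<close>

definition property_M :: "'a::metric_space itself \<Rightarrow> bool" where
  "property_M (_ :: 'a itself) \<longleftrightarrow>
     (\<exists>C\<^sub>1::real. \<forall>(x::'a) r. r > 0 \<longrightarrow>
       (\<forall>y \<in> cball x (r + 1). infdist y (cball x r) \<le> C\<^sub>1))"

end

theory Submission
  imports Defs
begin

text \<open>
  Fix a centre \<open>x\<close> and a radius \<open>r\<close>, and let \<open>A(w)\<close> be the collar of points whose distance to \<open>x\<close>
  lies in \<open>(r - w, r + 1]\<close>. The heart of the matter is that a fixed proportion of \<open>A(4w)\<close> lies
  outside \<open>A(w)\<close>, uniformly in \<open>x\<close>, \<open>r\<close> and \<open>w\<close>. Property (M) lets one walk from any point of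
  \<open>A(w)\<close> towards \<open>x\<close> with steps of bounded length, each of which gains at least 1. Such a walk is,
  up to a constant factor, as short as the depth that it reaches, and it cannot jump over a collar
  that is wider than one step; so every point of \<open>A(w)\<close> is within \<open>O(w)\<close> of the centre of a ball
  of radius \<open>w\<close> contained in \<open>A(4w) - A(w)\<close> (lemmas \<open>inward_walk\<close> and \<open>collar_inner_ball\<close>).
  Doubling and a covering argument (lemma \<open>measure_le_if_nearby_balls\<close>) turn this into
  \<open>\<mu>(A(w)) \<le> D * \<mu>(A(4w) - A(w))\<close>, that is, \<open>\<mu>(A(w)) \<le> D / (D + 1) * \<mu>(A(4w))\<close>.

  About \<open>log\<^sub>4 r\<close> successive scales fit between a constant width and \<open>r\<close>. Iterating the contraction
  over them bounds the measure of the shell by \<open>(D / (D + 1)) ^ (log\<^sub>4 r) = r powr (- \<delta>)\<close> times that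
  of the ball, up to constants, with \<open>\<delta> = log\<^sub>4 ((D + 1) / D)\<close>.
\<close>

section \<open>Walking towards the centre\<close>

text \<open>The infimum in Property (M) need not be attained, so a step length is a number strictly
  larger than the constant there.\<close>

lemma property_M_step:
  assumes "property_M TYPE('a::metric_space)"
  obtains L :: real where "L \<ge> 1"
    and "\<And>(x::'a) r y. \<lbrakk>r > 0; dist x y \<le> r + 1\<rbrakk> \<Longrightarrow> \<exists>z. dist x z \<le> r \<and> dist y z \<le> L"
proof -
  obtain C where C: "\<And>(x::'a) r y. \<lbrakk>r > 0; y \<in> cball x (r + 1)\<rbrakk> \<Longrightarrow> infdist y (cball x r) \<le> C"
    using assms unfolding property_M_def by blast
  show thesis
  proof (rule that[of "\<bar>C\<bar> + 1"])
    fix x y :: 'a and r :: real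
    assume r: "r > 0" and y: "dist x y \<le> r + 1"
    have "infdist y (cball x r) < \<bar>C\<bar> + 1"
      using C[OF r, of y x] y by simp
    moreover have "cball x r \<noteq> {}" using r by simp
    ultimately have "(INF z\<in>cball x r. dist y z) < \<bar>C\<bar> + 1"
      by (simp add: infdist_def)
    moreover have "bdd_below (dist y ` cball x r)" by (rule bdd_belowI[of _ 0]) auto
    ultimately obtain z where "z \<in> cball x r" "dist y z < \<bar>C\<bar> + 1"
      using \<open>cball x r \<noteq> {}\<close> by (auto simp: cINF_less_iff)
    then show "\<exists>z. dist x z \<le> r \<and> dist y z \<le> \<bar>C\<bar> + 1" by (intro exI[of _ z]) auto
  qed simp
qed

text \<open>Every step decreases the distance to \<open>x\<close> by at least 1, which bounds the number of steps
  until the walk first comes within \<open>t\<close> of \<open>x\<close>; since it decreases that distance by at most \<open>L\<close>,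
  the first such point is still farther than \<open>t - L\<close> from \<open>x\<close>.\<close>

lemma inward_walk:
  fixes x y :: "'a::metric_space"
  assumes L: "L \<ge> 1"
    and step: "\<And>(x::'a) r y. \<lbrakk>r > 0; dist x y \<le> r + 1\<rbrakk> \<Longrightarrow> \<exists>z. dist x z \<le> r \<and> dist y z \<le> L"
    and t: "t \<ge> 1" "dist x y > t"
  shows "\<exists>z. t - L < dist x z \<and> dist x z \<le> t \<and> dist y z \<le> L * (dist x y - t + 1)"
proof -
  have "\<exists>z. t - L < dist x z \<and> dist x z \<le> t \<and> dist y z \<le> L * (dist x y - t + 1)"
    if "dist x y > t" "dist x y - t \<le> real N" for N y
    using that
  proof (induction N arbitrary: y)
    case 0
    then show ?case by simp
  next
    case (Suc N)
    obtain y' where y': "dist x y' \<le> dist x y - 1" "dist y y' \<le> L"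
      using step[of "dist x y - 1" x y] Suc.prems t by auto
    show ?case
    proof (cases "dist x y' \<le> t")
      case True
      have "L * 1 \<le> L * (dist x y - t + 1)"
        using L Suc.prems by (intro mult_left_mono) auto
      then have "dist y y' \<le> L * (dist x y - t + 1)" using y' by linarith
      moreover have "dist x y \<le> dist x y' + dist y y'" by (metis dist_commute dist_triangle)
      ultimately show ?thesis using True y' Suc.prems by (intro exI[of _ y'] conjI) linarith+
    next
      case False
      then obtain z where z: "t - L < dist x z" "dist x z \<le> t" "dist y' z \<le> L * (dist x y' - t + 1)"
        using Suc.IH[of y'] y' Suc.prems by auto
      have "dist y z \<le> L + L * (dist x y' - t + 1)"
        using dist_triangle[of y z y'] y' z by linarith
      also have "\<dots> = L * (dist x y' + 1 - t + 1)" by (simp add: algebra_simps)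
      also have "\<dots> \<le> L * (dist x y - t + 1)"
        using L y' by (intro mult_left_mono) auto
      finally show ?thesis using z by auto
    qed
  qed
  from this[of y "nat \<lceil>dist x y - t\<rceil>"] show ?thesis
    using t by (auto simp: real_nat_ceiling_ge)
qed

definition collar :: "'a::metric_space \<Rightarrow> real \<Rightarrow> real \<Rightarrow> 'a set" where
  "collar x r w = cball x (r + 1) - cball x (r - w)"

lemma shell_eq_collar: "shell x r = collar x r 0"
  by (simp add: shell_def collar_def)

lemma collar_mono: "w \<le> w' \<Longrightarrow> collar x r w \<subseteq> collar x r w'"
  by (auto simp: collar_def)

text \<open>The centre is found by walking down to depth \<open>2w\<close>: the ball of radius \<open>w\<close> about it stays at
  depth at least \<open>w\<close>, and the overshoot of at most \<open>L \<le> w\<close> keeps it above depth \<open>4w\<close>.\<close>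

lemma collar_inner_ball:
  fixes x y :: "'a::metric_space"
  assumes L: "L \<ge> 1"
    and step: "\<And>(x::'a) r y. \<lbrakk>r > 0; dist x y \<le> r + 1\<rbrakk> \<Longrightarrow> \<exists>z. dist x z \<le> r \<and> dist y z \<le> L"
    and w: "L \<le> w" "4 * w \<le> r" and y: "y \<in> collar x r w"
  shows "\<exists>z. dist y z \<le> 4 * L * w \<and> cball z w \<subseteq> collar x r (4 * w) - collar x r w"
proof -
  have dy: "r - w < dist x y" "dist x y \<le> r + 1" using y by (auto simp: collar_def)
  obtain z where z: "r - 2 * w - L < dist x z" "dist x z \<le> r - 2 * w"
      "dist y z \<le> L * (dist x y - (r - 2 * w) + 1)"
    using inward_walk[OF L step, of "r - 2 * w" x y] dy w L by force
  have "L * (dist x y - (r - 2 * w) + 1) \<le> L * (4 * w)"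
    using dy w L by (intro mult_left_mono) auto
  then have "dist y z \<le> 4 * L * w" using z by (simp only: mult_ac)
  moreover have "u \<in> collar x r (4 * w) - collar x r w" if "u \<in> cball z w" for u
  proof -
    have "dist x u \<le> dist x z + dist z u" "dist x z \<le> dist x u + dist z u"
      using dist_triangle[of x u z] dist_triangle[of x z u] by (simp_all add: dist_commute)
    then show ?thesis using that z w L by (auto simp: collar_def)
  qed
  ultimately show ?thesis by blast
qed

section \<open>Covering in doubling spaces\<close>

locale doubling_measure =
  fixes M :: "'a::metric_space measure" and C\<^sub>0 :: real
  assumes sets_M: "sets M = sets borel"
    and ball_finite: "r > 0 \<Longrightarrow> emeasure M (cball x r) < \<infinity>"
    and ball_pos: "r > 0 \<Longrightarrow> 0 < measure M (cball x r)"
    and C\<^sub>0: "C\<^sub>0 \<ge> 1"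
    and double: "r > 0 \<Longrightarrow> measure M (cball x (2 * r)) \<le> C\<^sub>0 * measure M (cball x r)"

lemma doubling_measureI:
  assumes "metric_measured_space M" "doubling M"
  obtains C\<^sub>0 where "doubling_measure M C\<^sub>0"
proof -
  have M: "sets M = sets borel" "\<And>x r. r > 0 \<Longrightarrow> 0 < emeasure M (cball x r)"
      "\<And>x r. r > 0 \<Longrightarrow> emeasure M (cball x r) < \<infinity>"
    using assms(1) unfolding metric_measured_space_def by auto
  obtain C where C: "C \<ge> 1"
      "\<And>x r. r > 0 \<Longrightarrow> emeasure M (cball x (2 * r)) \<le> ennreal C * emeasure M (cball x r)"
    using assms(2) unfolding doubling_def by blast
  have eq: "emeasure M (cball x r) = ennreal (measure M (cball x r))" if "r > 0" for x r
    using M(3)[OF that, of x] by (intro emeasure_eq_ennreal_measure) auto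
  show thesis
  proof (rule that, unfold_locales)
    fix x and r :: real assume r: "r > 0"
    show "0 < measure M (cball x r)" using M(2)[OF r, of x] eq[OF r, of x] by simp
    have "ennreal (measure M (cball x (2 * r))) \<le> ennreal (C * measure M (cball x r))"
      using C(2)[OF r, of x] eq[OF r, of x] eq[of "2 * r" x] r C(1) by (simp add: ennreal_mult)
    then show "measure M (cball x (2 * r)) \<le> C * measure M (cball x r)"
      using C(1) by (simp add: ennreal_le_iff)
  qed (use M C in auto)
qed

context doubling_measure
begin

lemma bounded_fmeasurable:
  assumes "A \<in> sets borel" "A \<subseteq> cball x r"
  shows "A \<in> fmeasurable M"
proof -
  have "cball x (max r 1) \<in> fmeasurable M"
    using ball_finite[of "max r 1" x] by (intro fmeasurableI) (auto simp: sets_M)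
  then show ?thesis
    using assms by (rule_tac fmeasurableI2[of "cball x (max r 1)"]) (auto simp: sets_M)
qed

lemma measure_cball_mono:
  assumes "A \<subseteq> cball x r" "A \<in> sets borel"
  shows "measure M A \<le> measure M (cball x r)"
  using assms by (intro measure_mono_fmeasurable bounded_fmeasurable[of _ x r]) (auto simp: sets_M)

lemma double_power:
  assumes "r > 0"
  shows "measure M (cball x (2 ^ k * r)) \<le> C\<^sub>0 ^ k * measure M (cball x r)"
proof (induction k)
  case (Suc k)
  have "measure M (cball x (2 ^ Suc k * r)) \<le> C\<^sub>0 * measure M (cball x (2 ^ k * r))"
    using double[of "2 ^ k * r" x] assms by (simp add: mult.assoc)
  also have "\<dots> \<le> C\<^sub>0 * (C\<^sub>0 ^ k * measure M (cball x r))"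
    using Suc C\<^sub>0 by (intro mult_left_mono) auto
  finally show ?case by (simp add: mult.assoc)
qed simp

text \<open>A bounded set can contain only boundedly many disjoint balls of a given radius, because
  by doubling each of them carries a definite share of the measure of a large ball.\<close>

lemma disjoint_balls_card_bound:
  fixes x :: 'a
  assumes w: "w > 0"
  shows "\<exists>N. \<forall>F. finite F \<longrightarrow> disjoint_family_on (\<lambda>z. cball z w) F \<longrightarrow> (\<Union>z\<in>F. cball z w) \<subseteq> cball x \<rho>
            \<longrightarrow> card F \<le> N"
proof -
  define R where "R = max \<rho> w"
  have R: "R \<ge> w" "R \<ge> \<rho>" "R > 0" using w by (auto simp: R_def)
  obtain k where k: "2 * R / w < 2 ^ k" using real_arch_pow[of 2 "2 * R / w"] by auto
  have k': "2 * R \<le> 2 ^ k * w" using k w by (simp add: field_simps)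
  have "real (card F) \<le> C\<^sub>0 ^ k"
    if F: "finite F" "disjoint_family_on (\<lambda>z. cball z w) F" "(\<Union>z\<in>F. cball z w) \<subseteq> cball x \<rho>" for F
  proof -
    have share: "measure M (cball x R) \<le> C\<^sub>0 ^ k * measure M (cball z w)" if "z \<in> F" for z
    proof -
      have "z \<in> cball z w" using w by simp
      then have "z \<in> cball x \<rho>" using F(3) that by blast
      then have zx: "dist x z \<le> R" using R by simp
      have "cball x R \<subseteq> cball z (2 ^ k * w)"
      proof
        fix u assume "u \<in> cball x R"
        then show "u \<in> cball z (2 ^ k * w)"
          using zx dist_triangle[of z u x] k' by (auto simp: dist_commute)
      qed
      then have "measure M (cball x R) \<le> measure M (cball z (2 ^ k * w))"
        by (intro measure_cball_mono) auto
      also have "\<dots> \<le> C\<^sub>0 ^ k * measure M (cball z w)" by (rule double_power[OF w])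
      finally show ?thesis .
    qed
    have "real (card F) * measure M (cball x R) \<le> (\<Sum>z\<in>F. C\<^sub>0 ^ k * measure M (cball z w))"
      using share by (intro sum_bounded_below) auto
    also have "\<dots> = C\<^sub>0 ^ k * measure M (\<Union>z\<in>F. cball z w)"
      unfolding sum_distrib_left[symmetric] using F(1,2)
      by (subst measure_UNION') (auto simp: disjoint_family_on_def pairwise_def disjnt_def
            intro!: bounded_fmeasurable)
    also have "\<dots> \<le> C\<^sub>0 ^ k * measure M (cball x R)"
    proof (intro mult_left_mono measure_cball_mono)
      show "(\<Union>z\<in>F. cball z w) \<subseteq> cball x R" using F(3) subset_cball[OF R(2)] by blast
      show "(\<Union>z\<in>F. cball z w) \<in> sets borel" using F(1) by (intro sets.finite_UN) auto
      show "0 \<le> C\<^sub>0 ^ k" using C\<^sub>0 by simp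
    qed
    finally show ?thesis using ball_pos[OF R(3), of x] by simp
  qed
  then show ?thesis by (intro exI[of _ "nat \<lceil>C\<^sub>0 ^ k\<rceil>"]) (force simp: le_nat_iff le_ceiling_iff)
qed

text \<open>A Vitali-type comparison. In a maximal subset \<open>P\<close> of \<open>A\<close> with points more than
  \<open>2 * (a + w)\<close> apart, the balls \<open>cball (z p) w\<close> of different points are disjoint, whereas by
  maximality the balls of radius \<open>2 * (a + w)\<close> about \<open>P\<close> cover \<open>A\<close>. The latter are contained in
  balls of radius \<open>3 * a + 2 * w\<close> about the points \<open>z p\<close>, and doubling compares these with
  \<open>cball (z p) w\<close>.\<close>

lemma measure_le_if_nearby_balls:
  assumes w: "w > 0" and k: "3 * a + 2 * w \<le> 2 ^ k * w" and a: "a \<ge> 0"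
    and A: "A \<in> sets borel" and E: "E \<in> sets borel" "E \<subseteq> cball x \<rho>"
    and near: "\<And>y. y \<in> A \<Longrightarrow> \<exists>z. dist y z \<le> a \<and> cball z w \<subseteq> E"
  shows "measure M A \<le> C\<^sub>0 ^ k * measure M E"
proof -
  obtain z where z: "\<And>y. y \<in> A \<Longrightarrow> dist y (z y) \<le> a" "\<And>y. y \<in> A \<Longrightarrow> cball (z y) w \<subseteq> E"
    using near by metis
  define sep where "sep P \<longleftrightarrow> finite P \<and> P \<subseteq> A \<and> (\<forall>p\<in>P. \<forall>q\<in>P. p \<noteq> q \<longrightarrow> dist p q > 2 * (a + w))" for P
  have apart: "dist (z p) (z q) > 2 * w" if "sep P" "p \<in> P" "q \<in> P" "p \<noteq> q" for P p q
  proof -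
    have "p \<in> A" "q \<in> A" "dist p q > 2 * (a + w)" using that by (auto simp: sep_def)
    then show ?thesis
      using z(1)[of p] z(1)[of q] dist_triangle[of p q "z p"] dist_triangle[of "z p" q "z q"]
      by (simp add: dist_commute)
  qed
  have disj: "cball (z p) w \<inter> cball (z q) w = {}" if "sep P" "p \<in> P" "q \<in> P" "p \<noteq> q" for P p q
  proof -
    have "False" if "u \<in> cball (z p) w" "u \<in> cball (z q) w" for u
      using that apart[OF \<open>sep P\<close> \<open>p \<in> P\<close> \<open>q \<in> P\<close> \<open>p \<noteq> q\<close>] dist_triangle[of "z p" "z q" u]
      by (simp add: dist_commute)
    then show ?thesis by blast
  qed
  obtain N where N: "\<And>F. \<lbrakk>finite F; disjoint_family_on (\<lambda>z. cball z w) F; (\<Union>z\<in>F. cball z w) \<subseteq> cball x \<rho>\<rbrakk>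
        \<Longrightarrow> card F \<le> N"
    using disjoint_balls_card_bound[OF w, of x \<rho>] by auto
  have card: "card P \<le> N" if P: "sep P" for P
  proof -
    have "inj_on z P"
    proof (rule inj_onI, rule ccontr)
      fix p q assume "p \<in> P" "q \<in> P" "z p = z q" "p \<noteq> q"
      then show False using apart[OF P, of p q] w by simp
    qed
    moreover have "card (z ` P) \<le> N"
    proof (rule N)
      show "disjoint_family_on (\<lambda>z. cball z w) (z ` P)"
        unfolding disjoint_family_on_def using disj[OF P] by blast
      show "(\<Union>z\<in>z ` P. cball z w) \<subseteq> cball x \<rho>" using z(2) P E unfolding sep_def by blast
    qed (use P in \<open>auto simp: sep_def\<close>)
    ultimately show ?thesis by (simp add: card_image)
  qed
  have "sep {}" by (simp add: sep_def)
  then obtain P where P: "sep P" and Pmax: "\<And>Q. sep Q \<Longrightarrow> card Q \<le> card P"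
    using ex_has_greatest_nat[of sep "{}" card "Suc N"] card less_Suc_eq_le by metis
  have Pfin: "finite P" and PA: "P \<subseteq> A" using P by (auto simp: sep_def)
  have cover: "A \<subseteq> (\<Union>p\<in>P. cball p (2 * (a + w)))"
  proof
    fix y assume y: "y \<in> A"
    show "y \<in> (\<Union>p\<in>P. cball p (2 * (a + w)))"
    proof (rule ccontr)
      assume "\<not> ?thesis"
      then have far: "\<forall>p\<in>P. dist p y > 2 * (a + w)" by auto
      then have "y \<notin> P" using a w by force
      moreover have "sep (insert y P)" using P far y by (auto simp: sep_def dist_commute)
      ultimately show False using Pmax[of "insert y P"] Pfin by simp
    qed
  qed
  have "measure M A \<le> measure M (\<Union>p\<in>P. cball p (2 * (a + w)))"
    using cover A Pfin
    by (intro measure_mono_fmeasurable fmeasurable.finite_UN)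
       (auto simp: sets_M intro!: bounded_fmeasurable)
  also have "\<dots> \<le> (\<Sum>p\<in>P. measure M (cball p (2 * (a + w))))"
    using Pfin by (intro measure_UNION_le) (auto simp: sets_M)
  also have "\<dots> \<le> (\<Sum>p\<in>P. C\<^sub>0 ^ k * measure M (cball (z p) w))"
  proof (rule sum_mono)
    fix p assume p: "p \<in> P"
    have "cball p (2 * (a + w)) \<subseteq> cball (z p) (2 ^ k * w)"
    proof
      fix u assume "u \<in> cball p (2 * (a + w))"
      then show "u \<in> cball (z p) (2 ^ k * w)"
        using z(1)[of p] p PA dist_triangle[of "z p" u p] k by (auto simp: dist_commute)
    qed
    then have "measure M (cball p (2 * (a + w))) \<le> measure M (cball (z p) (2 ^ k * w))"
      by (intro measure_cball_mono) auto
    also have "\<dots> \<le> C\<^sub>0 ^ k * measure M (cball (z p) w)" by (rule double_power[OF w])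
    finally show "measure M (cball p (2 * (a + w))) \<le> C\<^sub>0 ^ k * measure M (cball (z p) w)" .
  qed
  also have "\<dots> = C\<^sub>0 ^ k * measure M (\<Union>p\<in>P. cball (z p) w)"
    unfolding sum_distrib_left[symmetric] using Pfin disj[OF P]
    by (subst measure_UNION') (auto simp: pairwise_def disjnt_def intro!: bounded_fmeasurable)
  also have "\<dots> \<le> C\<^sub>0 ^ k * measure M E"
    using z(2) PA C\<^sub>0 Pfin E
    by (intro mult_left_mono measure_mono_fmeasurable bounded_fmeasurable[OF E])
       (auto simp: sets_M intro!: sets.finite_UN)
  finally show ?thesis .
qed

section \<open>Decay of collars and shells\<close>

lemma collar_borel: "collar x r w \<in> sets borel"
  by (auto simp: collar_def)

lemma collar_subset: "collar x r w \<subseteq> cball x (r + 1)"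
  by (auto simp: collar_def)

text \<open>The constant 14 comes from the covering estimate: here \<open>a = 4 * L * w\<close>, hence
  \<open>3 * a + 2 * w \<le> 14 * L * w\<close>.\<close>

lemma collar_contraction:
  assumes L: "L \<ge> 1"
    and step: "\<And>(x::'a) r y. \<lbrakk>r > 0; dist x y \<le> r + 1\<rbrakk> \<Longrightarrow> \<exists>z. dist x z \<le> r \<and> dist y z \<le> L"
    and k: "14 * L \<le> 2 ^ k" and w: "L \<le> w" "4 * w \<le> r"
  shows "measure M (collar x r w) \<le> C\<^sub>0 ^ k / (C\<^sub>0 ^ k + 1) * measure M (collar x r (4 * w))"
proof -
  have "2 * w \<le> 2 * L * w" using L w by simp
  then have "3 * (4 * L * w) + 2 * w \<le> 14 * L * w" by linarith
  also have "\<dots> \<le> 2 ^ k * w" using k L w by (intro mult_right_mono) auto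
  finally have scale: "3 * (4 * L * w) + 2 * w \<le> 2 ^ k * w" .
  have "measure M (collar x r w) \<le> C\<^sub>0 ^ k * measure M (collar x r (4 * w) - collar x r w)"
  proof (rule measure_le_if_nearby_balls[OF _ scale])
    show "collar x r (4 * w) - collar x r w \<subseteq> cball x (r + 1)" using collar_subset by blast
  qed (use collar_inner_ball[OF L step w, of _ x] L w in \<open>auto intro: collar_borel\<close>)
  also have "measure M (collar x r (4 * w) - collar x r w)
      = measure M (collar x r (4 * w)) - measure M (collar x r w)"
    using collar_mono[of w "4 * w" x r] L w
    by (intro measurable_measure_Diff bounded_fmeasurable[OF collar_borel collar_subset])
       (auto simp: sets_M collar_borel)
  finally have "(C\<^sub>0 ^ k + 1) * measure M (collar x r w) \<le> C\<^sub>0 ^ k * measure M (collar x r (4 * w))"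
    by (simp add: algebra_simps)
  moreover have "C\<^sub>0 ^ k + 1 > 0" using C\<^sub>0 by (simp add: add_pos_pos)
  ultimately show ?thesis by (simp add: field_simps)
qed

lemma collar_iterate:
  assumes \<theta>: "\<theta> \<ge> 0" and L: "L > 0"
    and contract: "\<And>w. \<lbrakk>L \<le> w; 4 * w \<le> r\<rbrakk> \<Longrightarrow> measure M (collar x r w) \<le> \<theta> * measure M (collar x r (4 * w))"
    and "4 ^ j * L \<le> r"
  shows "measure M (collar x r L) \<le> \<theta> ^ j * measure M (collar x r (4 ^ j * L))"
  using assms(4)
proof (induction j)
  case (Suc j)
  have "1 * L \<le> 4 ^ j * L" using L by (intro mult_right_mono) auto
  then have "measure M (collar x r (4 ^ j * L)) \<le> \<theta> * measure M (collar x r (4 * (4 ^ j * L)))"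
    using Suc.prems by (intro contract) auto
  then have "\<theta> ^ j * measure M (collar x r (4 ^ j * L)) \<le> \<theta> ^ j * (\<theta> * measure M (collar x r (4 * (4 ^ j * L))))"
    using \<theta> by (intro mult_left_mono) auto
  moreover have "measure M (collar x r L) \<le> \<theta> ^ j * measure M (collar x r (4 ^ j * L))"
    using Suc.prems \<open>1 * L \<le> 4 ^ j * L\<close> L unfolding power_Suc mult.assoc by (intro Suc.IH) linarith
  ultimately show ?case by (simp add: mult_ac)
qed simp

lemma shell_decay:
  assumes "property_M TYPE('a)"
  shows "\<exists>\<delta>>0. \<exists>C. \<forall>(x::'a) r. r \<ge> 1 \<longrightarrow>
           measure M (shell x r) \<le> C * r powr (- \<delta>) * measure M (cball x r)"
proof -
  obtain L where L: "L \<ge> 1"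
    and step: "\<And>(x::'a) r y. \<lbrakk>r > 0; dist x y \<le> r + 1\<rbrakk> \<Longrightarrow> \<exists>z. dist x z \<le> r \<and> dist y z \<le> L"
    using property_M_step[OF assms] by metis
  obtain k where "14 * L < 2 ^ k" using real_arch_pow[of 2 "14 * L"] by auto
  then have k: "14 * L \<le> 2 ^ k" by simp
  define \<theta> where "\<theta> = C\<^sub>0 ^ k / (C\<^sub>0 ^ k + 1)"
  have pos: "C\<^sub>0 ^ k > 0" using C\<^sub>0 by simp
  have \<theta>: "0 < \<theta>" "\<theta> < 1" using pos by (auto simp: \<theta>_def field_simps add_pos_pos)
  define \<delta> where "\<delta> = - log 4 \<theta>"
  have \<delta>: "\<delta> > 0" using \<theta> by (simp add: \<delta>_def)
  have \<theta>_eq: "\<theta> = 4 powr (- \<delta>)" using \<theta> by (simp add: \<delta>_def)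
  have "measure M (shell x r) \<le> C\<^sub>0 * (4 * L) powr \<delta> * r powr (- \<delta>) * measure M (cball x r)"
    if r: "r \<ge> 1" for x :: 'a and r
  proof -
    have big: "measure M (collar x r w) \<le> C\<^sub>0 * measure M (cball x r)" for w
    proof -
      have "measure M (collar x r w) \<le> measure M (cball x (2 * r))"
        using r by (intro measure_cball_mono collar_borel) (auto simp: collar_def)
      also have "\<dots> \<le> C\<^sub>0 * measure M (cball x r)" using r by (intro double) auto
      finally show ?thesis .
    qed
    \<comment> \<open>Radii up to \<open>L\<close> leave no room for a single scale; they are covered by the case \<open>j = 0\<close>.\<close>
    obtain j where j: "measure M (shell x r) \<le> \<theta> ^ j * (C\<^sub>0 * measure M (cball x r))"
      and jr: "r \<le> 4 * L * 4 ^ j"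
    proof (cases "r \<le> L")
      case True
      then show thesis using big[of 0] L by (intro that[of 0]) (auto simp: shell_eq_collar)
    next
      case False
      obtain N where "r / L < 4 ^ N" using real_arch_pow[of 4 "r / L"] by auto
      then have N: "r < 4 ^ N * L" using L by (simp add: field_simps)
      define i where "i = (LEAST i. r < 4 ^ i * L)"
      have i: "r < 4 ^ i * L" unfolding i_def using N by (rule LeastI)
      obtain j where ij: "i = Suc j" using i False by (cases i) auto
      then have "\<not> r < 4 ^ j * L" unfolding i_def using not_less_Least[of j "\<lambda>i. r < 4 ^ i * L"] by simp
      then have jL: "4 ^ j * L \<le> r" by simp
      have "measure M (shell x r) \<le> measure M (collar x r L)"
        unfolding shell_eq_collar using L collar_mono[of 0 L x r]
        by (intro measure_mono_fmeasurable bounded_fmeasurable[OF collar_borel collar_subset])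
           (auto simp: sets_M collar_borel)
      also have "\<dots> \<le> \<theta> ^ j * measure M (collar x r (4 ^ j * L))"
        using \<theta> L jL collar_contraction[OF L step k] unfolding \<theta>_def[symmetric]
        by (intro collar_iterate) auto
      also have "\<dots> \<le> \<theta> ^ j * (C\<^sub>0 * measure M (cball x r))"
        using big \<theta> by (intro mult_left_mono) auto
      finally show thesis using i ij by (intro that[of j]) (auto simp: mult_ac)
    qed
    have "\<theta> ^ j = (4 ^ j) powr (- \<delta>)"
      unfolding \<theta>_eq by (simp add: powr_powr powr_realpow[symmetric] mult_ac)
    also have "\<dots> \<le> (r / (4 * L)) powr (- \<delta>)"
      using \<delta> jr r L by (intro powr_mono2') (auto simp: field_simps)
    also have "\<dots> = (4 * L) powr \<delta> * r powr (- \<delta>)"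
      using r L by (simp add: powr_divide powr_minus field_simps)
    finally have "\<theta> ^ j * (C\<^sub>0 * measure M (cball x r))
        \<le> (4 * L) powr \<delta> * r powr (- \<delta>) * (C\<^sub>0 * measure M (cball x r))"
      using C\<^sub>0 by (intro mult_right_mono) auto
    with j show ?thesis by (simp add: mult_ac)
  qed
  with \<delta> show ?thesis by blast
qed

end

theorem theorem4:
  fixes M :: "'a::metric_space measure"
  assumes "metric_measured_space M"
    and "doubling M"
    and "property_M TYPE('a)"
  shows "(\<exists>\<delta>::real. \<delta> > 0 \<and> (\<exists>C::real. \<forall>(x::'a) (n::nat). n \<ge> 1 \<longrightarrow>
            measure M (shell x (real n))
              \<le> C * real n powr (- \<delta>) * measure M (cball x (real n)))) \<and>
         uniform_limit UNIV
           (\<lambda>(n::nat) (x::'a). measure M (cball x (real n + 1) - cball x (real n)) / measure M (cball x (real n)))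
           (\<lambda>x. 0) sequentially"
proof -
  obtain C\<^sub>0 where "doubling_measure M C\<^sub>0" using doubling_measureI[OF assms(1,2)] .
  then interpret doubling_measure M C\<^sub>0 .
  obtain \<delta> C where \<delta>: "\<delta> > 0" and C: "\<And>(x::'a) r. r \<ge> 1 \<Longrightarrow>
      measure M (shell x r) \<le> C * r powr (- \<delta>) * measure M (cball x r)"
    using shell_decay[OF assms(3)] by blast
  have "uniform_limit UNIV
      (\<lambda>(n::nat) (x::'a). measure M (cball x (real n + 1) - cball x (real n)) / measure M (cball x (real n)))
      (\<lambda>x. 0) sequentially"
  proof (rule uniform_limitI)
    fix e :: real assume e: "e > 0"
    have "(\<lambda>n. C * real n powr (- \<delta>)) \<longlonglongrightarrow> C * 0"
      using \<delta> by (intro tendsto_mult tendsto_const tendsto_neg_powr filterlim_real_sequentially) auto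
    then have "eventually (\<lambda>n. C * real n powr (- \<delta>) < e) sequentially"
      using e by (intro order_tendstoD) auto
    with eventually_ge_at_top[of 1]
    show "\<forall>\<^sub>F n in sequentially. \<forall>x\<in>UNIV. dist (measure M (cball (x::'a) (real n + 1) - cball x (real n))
        / measure M (cball x (real n))) 0 < e"
    proof eventually_elim
      case (elim n)
      have "measure M (cball x (real n + 1) - cball x (real n)) / measure M (cball x (real n))
          \<le> C * real n powr (- \<delta>)" for x :: 'a
        using C[of "real n" x] ball_pos[of "real n" x] elim
        by (simp add: shell_def divide_le_eq)
      with elim show ?case by (auto intro: le_less_trans)
    qed
  qed
  with \<delta> C show ?thesis
    by (intro conjI exI[of _ \<delta>] exI[of _ C]) auto
qed

end
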